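(* Let $K$ be a compact semihypergroup. If $K$ is right amenable, i.e., if $C(K)$ admits a right invariant mean, then $K$ has a unique minimal left ideal.
   Context: All topologies are Hausdorff. For a locally compact Hausdorff space $X$: $M(X)$ is the space of regular complex Borel measures on $X$; $M^+(X)$ is the set of finite non-negative regular Borel measures, with the cone topology (the weakest topology making $\mu\mapsto\int_X f\,d\mu$ continuous for every $f\in C_c^+(X)\cup\{1_X\}$, where $C_c^+(X)$ is the set of non-negative compactly supported continuous functions and $1_X$ is the constant function $1$); $\mathfrak{C}(X)$ is the set of compact subsets of $X$ with the Michael topology, generated by the sub-basis of sets $\{C\in\mathfrak{C}(X): C\cap U\neq\emptyset,\ C\subset V\}$ for $U,V$ open in $X$; $p_x$ is the point mass at $x$. A semihypergroup is a pair $(K,* )$ such that: (A1) $K$ is a locally compact Hausdorff space and $*$ is a binary operation making $M(K)$ an associative algebra; (A2) the bilinear map $*$ sends $M^+(K)\times M^+(K)$ into $M^+(K)$ and its restriction to $M^+(K)\times M^+(K)$ is (jointly) continuous; (A3) for all $x,y\in K$, $p_x*p_y$ is a probability measure with compact support; (A4) the map $(x,y)\mapsto \mathrm{supp}(p_x*p_y)$, $K\times K\to\mathfrak{C}(K)$, is continuous. It is compact if $K$ is compact. $C(K)$ is the space of bounded continuous complex-valued functions on $K$ with the supremum norm. For $f\in C(K)$ and $x,y\in K$, $R_yf(x)=f(x*y):=\int_K f\,d(p_x*p_y)$. A mean on $C(K)$ is $m\in C(K)^*$ with $\|m\|=1=m(1)$; it is a right invariant mean if $m(R_xf)=m(f)$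 for all $x\in K$, $f\in C(K)$. A left ideal is a set $I\subset K$ with $(p_x*p_a)(I)=1$ for all $x\in K$, $a\in I$. All ideals are assumed closed and non-empty; so a closed non-empty $I$ is a left ideal iff $\mathrm{supp}(p_x*p_a)\subset I$ for all $x\in K$, $a\in I$. A left ideal is minimal if it contains no proper left ideal of $K$. *)

theory Defs
  imports "HOL-Analysis.Analysis"
begin

(* A complex Borel measure is a countably additive set function with values in the complex
   numbers. It is set to 0 outside the Borel sets, so that equality of functions is equality
   of measures. *)
definition complex_borel_measure :: "('a::topological_space set \<Rightarrow> complex) \<Rightarrow> bool" where
  "complex_borel_measure \<mu> \<longleftrightarrow>
     (\<forall>E. E \<notin> sets borel \<longrightarrow> \<mu> E = 0) \<and>
     (\<forall>A :: nat \<Rightarrow> 'a set. range A \<subseteq> sets borel \<longrightarrow> disjoint_family A \<longrightarrow>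
        (\<lambda>n. \<mu> (A n)) sums \<mu> (\<Union>n. A n))"

definition total_variation :: "('a::topological_space set \<Rightarrow> complex) \<Rightarrow> 'a set \<Rightarrow> ennreal" where
  "total_variation \<mu> E =
     (SUP A \<in> {A :: nat \<Rightarrow> 'a set. range A \<subseteq> sets borel \<and> disjoint_family A \<and> (\<Union>n. A n) = E}.
        (\<Sum>n. ennreal (cmod (\<mu> (A n)))))"

definition regular_measure :: "('a::topological_space set \<Rightarrow> complex) \<Rightarrow> bool" where
  "regular_measure \<mu> \<longleftrightarrow>
     (\<forall>E \<in> sets borel.
        total_variation \<mu> E = (INF U \<in> {U. open U \<and> E \<subseteq> U}. total_variation \<mu> U) \<and>
        total_variation \<mu> E = (SUP C \<in> {C. compact C \<and> C \<subseteq> E}. total_variation \<mu> C))"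

definition regular_measures :: "('a::t2_space set \<Rightarrow> complex) set" where
  "regular_measures = {\<mu>. complex_borel_measure \<mu> \<and> regular_measure \<mu>}"

definition nonneg_measures :: "('a::t2_space set \<Rightarrow> complex) set" where
  "nonneg_measures = {\<mu> \<in> regular_measures. \<forall>E. \<mu> E \<in> \<real>\<^sub>\<ge>\<^sub>0}"

(* The library measure given by an element of nonneg_measures; used for integration. *)
definition to_measure :: "('a::t2_space set \<Rightarrow> complex) \<Rightarrow> 'a measure" where
  "to_measure \<mu> = measure_of UNIV (sets borel) (\<lambda>E. ennreal (Re (\<mu> E)))"

definition point_mass :: "'a::t2_space \<Rightarrow> 'a set \<Rightarrow> complex" where
  "point_mass x E = (if E \<in> sets borel \<and> x \<in> E then 1 else 0)"

definition supp :: "('a::t2_space set \<Rightarrow> complex) \<Rightarrow> 'a set" where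
  "supp \<mu> = {x. \<forall>U. open U \<longrightarrow> x \<in> U \<longrightarrow> total_variation \<mu> U \<noteq> 0}"

definition Cc_plus :: "('a::t2_space \<Rightarrow> real) set" where
  "Cc_plus = {f. continuous_on UNIV f \<and> (\<forall>x. 0 \<le> f x) \<and> compact (closure {x. f x \<noteq> 0})}"

definition cone_topology :: "('a::t2_space set \<Rightarrow> complex) topology" where
  "cone_topology = topology_generated_by
     {{\<mu> \<in> nonneg_measures. integral\<^sup>L (to_measure \<mu>) f \<in> W} | f W. f \<in> Cc_plus \<union> {\<lambda>x. 1} \<and> open W}"

(* The whole space (the empty intersection of sub-basic sets) has to be inserted explicitly,
   because the empty set lies in no sub-basic set. *)
definition michael_topology :: "'a::t2_space set topology" where
  "michael_topology = topology_generated_by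
     (insert {C. compact C}
        {{C. compact C \<and> C \<inter> U \<noteq> {} \<and> C \<subseteq> V} | U V. open U \<and> open V})"

locale semihypergroup =
  fixes conv :: "('a::t2_space set \<Rightarrow> complex) \<Rightarrow> ('a set \<Rightarrow> complex) \<Rightarrow> ('a set \<Rightarrow> complex)"
  assumes locally_compact: "locally_compact_space (euclidean :: 'a topology)"
    and conv_closed: "\<lbrakk>\<mu> \<in> regular_measures; \<nu> \<in> regular_measures\<rbrakk> \<Longrightarrow> conv \<mu> \<nu> \<in> regular_measures"
    and conv_add_left: "\<lbrakk>\<mu> \<in> regular_measures; \<mu>' \<in> regular_measures; \<nu> \<in> regular_measures\<rbrakk> \<Longrightarrow>
      conv (\<lambda>E. \<mu> E + \<mu>' E) \<nu> = (\<lambda>E. conv \<mu> \<nu> E + conv \<mu>' \<nu> E)"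
    and conv_add_right: "\<lbrakk>\<mu> \<in> regular_measures; \<nu> \<in> regular_measures; \<nu>' \<in> regular_measures\<rbrakk> \<Longrightarrow>
      conv \<mu> (\<lambda>E. \<nu> E + \<nu>' E) = (\<lambda>E. conv \<mu> \<nu> E + conv \<mu> \<nu>' E)"
    and conv_scale_left: "\<lbrakk>\<mu> \<in> regular_measures; \<nu> \<in> regular_measures\<rbrakk> \<Longrightarrow>
      conv (\<lambda>E. c * \<mu> E) \<nu> = (\<lambda>E. c * conv \<mu> \<nu> E)"
    and conv_scale_right: "\<lbrakk>\<mu> \<in> regular_measures; \<nu> \<in> regular_measures\<rbrakk> \<Longrightarrow>
      conv \<mu> (\<lambda>E. c * \<nu> E) = (\<lambda>E. c * conv \<mu> \<nu> E)"
    and conv_assoc: "\<lbrakk>\<mu> \<in> regular_measures; \<nu> \<in> regular_measures; \<rho> \<in> regular_measures\<rbrakk> \<Longrightarrow>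
      conv (conv \<mu> \<nu>) \<rho> = conv \<mu> (conv \<nu> \<rho>)"
    and conv_nonneg: "\<lbrakk>\<mu> \<in> nonneg_measures; \<nu> \<in> nonneg_measures\<rbrakk> \<Longrightarrow> conv \<mu> \<nu> \<in> nonneg_measures"
    and conv_continuous: "continuous_map (prod_topology cone_topology cone_topology) cone_topology
      (\<lambda>(\<mu>, \<nu>). conv \<mu> \<nu>)"
    and conv_point_mass_prob: "conv (point_mass x) (point_mass y) \<in> nonneg_measures"
      "conv (point_mass x) (point_mass y) UNIV = 1"
    and conv_point_mass_supp: "compact (supp (conv (point_mass x) (point_mass y)))"
    and supp_continuous: "continuous_map (prod_topology euclidean euclidean) michael_topology
      (\<lambda>(x, y). supp (conv (point_mass x) (point_mass y)))"

definition right_translate ::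
    "(('a::t2_space set \<Rightarrow> complex) \<Rightarrow> ('a set \<Rightarrow> complex) \<Rightarrow> ('a set \<Rightarrow> complex)) \<Rightarrow>
     'a \<Rightarrow> ('a \<Rightarrow> complex) \<Rightarrow> 'a \<Rightarrow> complex" where
  "right_translate conv y f x =
     integral\<^sup>L (to_measure (conv (point_mass x) (point_mass y))) f"

(* Continuous dual of C(K): a real-linear bounded functional that is complex homogeneous. Its
   norm as a complex functional is its onorm. *)
definition is_mean :: "(('a::t2_space \<Rightarrow>\<^sub>C complex) \<Rightarrow> complex) \<Rightarrow> bool" where
  "is_mean m \<longleftrightarrow>
     bounded_linear m \<and>
     (\<forall>c f. m (Bcontfun (\<lambda>x. c * apply_bcontfun f x)) = c * m f) \<and>
     onorm m = 1 \<and> m (const_bcontfun 1) = 1"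

(* Bcontfun is meaningful here: in a semihypergroup the right translates of a bounded
   continuous function are bounded and continuous, because
   (x, y) |-> p_x * p_y takes probability measures as values and is jointly continuous for the
   cone topology. *)
definition right_invariant_mean ::
    "(('a::t2_space set \<Rightarrow> complex) \<Rightarrow> ('a set \<Rightarrow> complex) \<Rightarrow> ('a set \<Rightarrow> complex)) \<Rightarrow>
     (('a \<Rightarrow>\<^sub>C complex) \<Rightarrow> complex) \<Rightarrow> bool" where
  "right_invariant_mean conv m \<longleftrightarrow>
     is_mean m \<and> (\<forall>y f. m (Bcontfun (right_translate conv y (apply_bcontfun f))) = m f)"

definition right_amenable ::
    "(('a::t2_space set \<Rightarrow> complex) \<Rightarrow> ('a set \<Rightarrow> complex) \<Rightarrow> ('a set \<Rightarrow> complex)) \<Rightarrow> bool" where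
  "right_amenable conv \<longleftrightarrow> (\<exists>m. right_invariant_mean conv m)"

definition left_ideal ::
    "(('a::t2_space set \<Rightarrow> complex) \<Rightarrow> ('a set \<Rightarrow> complex) \<Rightarrow> ('a set \<Rightarrow> complex)) \<Rightarrow>
     'a set \<Rightarrow> bool" where
  "left_ideal conv I \<longleftrightarrow>
     closed I \<and> I \<noteq> {} \<and> (\<forall>x. \<forall>a \<in> I. conv (point_mass x) (point_mass a) I = 1)"

definition minimal_left_ideal ::
    "(('a::t2_space set \<Rightarrow> complex) \<Rightarrow> ('a set \<Rightarrow> complex) \<Rightarrow> ('a set \<Rightarrow> complex)) \<Rightarrow>
     'a set \<Rightarrow> bool" where
  "minimal_left_ideal conv I \<longleftrightarrow>
     left_ideal conv I \<and> (\<forall>J. left_ideal conv J \<longrightarrow> J \<subseteq> I \<longrightarrow> J = I)"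

end

theory Submission
  imports Defs
begin

text \<open>
  Existence is Zorn's lemma for closed sets under reverse inclusion. The intersection of a chain of
  left ideals is non-empty because the space is compact. For \<open>a\<close> in it, all the mass of
  \<open>p\<^sub>x * p\<^sub>a\<close> still lies in it, because that measure is regular: a compact subset of the union of
  the complements lies in a single one of them, which is a null set.

  For uniqueness, two distinct minimal left ideals \<open>I\<close> and \<open>J\<close> are disjoint, so
  Urysohn's lemma gives a continuous \<open>f\<close> that is \<open>1\<close> on \<open>I\<close> and \<open>0\<close> on \<open>J\<close>.
  If \<open>y\<close> lies in \<open>I\<close> then all the measures \<open>p\<^sub>x * p\<^sub>y\<close> live on \<open>I\<close>, so the
  translate of \<open>f\<close> by \<open>y\<close> is the constant \<open>1\<close>; if \<open>y\<close> lies in \<open>J\<close>, it is the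
  constant \<open>0\<close>. An invariant mean would give \<open>f\<close> both values, whence \<open>1 = 0\<close>.
\<close>

lemma emeasure_to_measure:
  fixes \<mu> :: "'a::t2_space set \<Rightarrow> complex"
  assumes \<mu>: "\<mu> \<in> nonneg_measures" and E: "E \<in> sets borel"
  shows "emeasure (to_measure \<mu>) E = ennreal (Re (\<mu> E))"
proof -
  have sums: "(\<lambda>n. \<mu> (A n)) sums \<mu> (\<Union>n. A n)"
    if "range A \<subseteq> sets borel" "disjoint_family A" for A :: "nat \<Rightarrow> 'a set"
    using \<mu> that by (auto simp: nonneg_measures_def regular_measures_def complex_borel_measure_def)
  have nonneg: "0 \<le> Re (\<mu> A)" for A
    using \<mu> by (simp add: nonneg_measures_def complex_nonneg_Reals_iff)
  have "(\<lambda>n::nat. \<mu> {}) sums \<mu> {}"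
    using sums[of "\<lambda>_. {}"] by (simp add: disjoint_family_on_def)
  then have empty: "\<mu> {} = 0"
    using sums_summable summable_const_iff by blast
  have "countably_additive (sets borel) (\<lambda>E. ennreal (Re (\<mu> E)))"
    unfolding countably_additive_def
  proof (intro allI impI)
    fix A :: "nat \<Rightarrow> 'a set" assume "range A \<subseteq> sets borel" "disjoint_family A"
    then have "(\<lambda>n. Re (\<mu> (A n))) sums Re (\<mu> (\<Union>n. A n))"
      using sums sums_Re by blast
    then show "(\<Sum>n. ennreal (Re (\<mu> (A n)))) = ennreal (Re (\<mu> (\<Union>n. A n)))"
      by (intro suminf_ennreal_eq nonneg)
  qed
  moreover have "positive (sets borel) (\<lambda>E. ennreal (Re (\<mu> E)))"
    by (simp add: positive_def empty)
  moreover have "sigma_algebra UNIV (sets borel :: 'a set set)"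
    by (metis sets.sigma_algebra_axioms space_borel)
  ultimately show ?thesis
    unfolding to_measure_def by (intro emeasure_measure_of_sigma E)
qed

lemma space_to_measure [simp]: "space (to_measure \<mu>) = UNIV"
  by (simp add: to_measure_def space_measure_of_conv)

lemma sets_to_measure [simp]: "sets (to_measure \<mu>) = sets borel"
  using sets.sigma_sets_eq[of borel] by (simp add: to_measure_def)

text \<open>Every countable Borel partition of a Borel set \<open>E\<close> contributes exactly the mass of
  \<open>E\<close>, since no cancellation occurs. Regularity thus becomes a statement about
  the measure itself.\<close>

lemma total_variation_nonneg:
  fixes \<mu> :: "'a::t2_space set \<Rightarrow> complex"
  assumes \<mu>: "\<mu> \<in> nonneg_measures" and E: "E \<in> sets borel"
  shows "total_variation \<mu> E = emeasure (to_measure \<mu>) E"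
proof -
  let ?P = "{A :: nat \<Rightarrow> 'a set. range A \<subseteq> sets borel \<and> disjoint_family A \<and> (\<Union>n. A n) = E}"
  have "cmod (\<mu> B) = Re (\<mu> B)" for B
    using \<mu> by (auto simp: nonneg_measures_def cmod_def complex_nonneg_Reals_iff)
  then have "(\<Sum>n. ennreal (cmod (\<mu> (A n)))) = emeasure (to_measure \<mu>) E" if "A \<in> ?P" for A
    using that \<mu> suminf_emeasure[of A "to_measure \<mu>"]
    by (auto simp: emeasure_to_measure[symmetric] range_subsetD)
  moreover have "(\<lambda>n. if n = 0 then E else {}) \<in> ?P"
    using E by (auto simp: disjoint_family_on_def split: if_splits)
  ultimately show ?thesis
    unfolding total_variation_def by (intro SUP_eq_const) blast+
qed

lemma emeasure_inner_regular:
  assumes \<mu>: "\<mu> \<in> nonneg_measures" and E: "E \<in> sets borel"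
  shows "emeasure (to_measure \<mu>) E =
    (SUP C \<in> {C. compact C \<and> C \<subseteq> E}. emeasure (to_measure \<mu>) C)"
proof -
  have "total_variation \<mu> E = (SUP C \<in> {C. compact C \<and> C \<subseteq> E}. total_variation \<mu> C)"
    using \<mu> E unfolding nonneg_measures_def regular_measures_def regular_measure_def by blast
  also have "\<dots> = (SUP C \<in> {C. compact C \<and> C \<subseteq> E}. emeasure (to_measure \<mu>) C)"
    by (intro SUP_cong) (auto simp: total_variation_nonneg \<mu> compact_imp_closed)
  finally show ?thesis
    by (simp add: total_variation_nonneg \<mu> E)
qed

text \<open>A finite non-empty subfamily of a chain contains its own union, so a finite subcover
  reduces to one member.\<close>

lemma compact_subset_Union_chain:
  assumes "compact D" "D \<subseteq> \<Union>\<C>" "subset.chain \<A> \<C>" "\<C> \<noteq> {}" "\<And>U. U \<in> \<C> \<Longrightarrow> open U"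
  obtains U where "U \<in> \<C>" "D \<subseteq> U"
proof -
  obtain \<F> where \<F>: "\<F> \<subseteq> \<C>" "finite \<F>" "D \<subseteq> \<Union>\<F>"
    using assms(1,2,5) by (meson compactE)
  show thesis
  proof (cases "\<F> = {}")
    case True
    then have "D = {}" using \<F>(3) by simp
    then show ?thesis using assms(4) that by (metis all_not_in_conv empty_subsetI)
  next
    case False
    have "subset.chain \<A> \<F>"
      using assms(3) \<F>(1) unfolding subset_chain_def by (meson subsetD subset_trans)
    then have "\<Union>\<F> \<in> \<F>"
      using False \<F>(2) by (simp add: Union_in_chain)
    then show ?thesis using \<F>(1,3) that[of "\<Union>\<F>"] by blast
  qed
qed

text \<open>The chain may be uncountable, so countable additivity does not suffice; inner regularity
  reduces the claim to compact sets, which lie in a single member.\<close>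

lemma emeasure_Union_chain_null:
  assumes \<mu>: "\<mu> \<in> nonneg_measures" and chain: "subset.chain \<A> \<C>" "\<C> \<noteq> {}"
    and opens: "\<And>U. U \<in> \<C> \<Longrightarrow> open U"
    and null: "\<And>U. U \<in> \<C> \<Longrightarrow> emeasure (to_measure \<mu>) U = 0"
  shows "emeasure (to_measure \<mu>) (\<Union>\<C>) = 0"
proof -
  have "emeasure (to_measure \<mu>) D = 0" if D: "compact D" "D \<subseteq> \<Union>\<C>" for D
  proof -
    obtain U where U: "U \<in> \<C>" "D \<subseteq> U"
      using compact_subset_Union_chain[OF D chain] opens by blast
    have "emeasure (to_measure \<mu>) D \<le> emeasure (to_measure \<mu>) U"
      by (intro emeasure_mono U) (use opens U in auto)
    then show ?thesis using null U by simp
  qed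
  moreover have "\<Union>\<C> \<in> sets borel"
    using opens by (simp add: open_Union)
  ultimately show ?thesis
    by (simp add: emeasure_inner_regular[OF \<mu>, of "\<Union>\<C>"] SUP_constant bot_ennreal)
qed

context semihypergroup
begin

text \<open>Passing to null complements turns both finite and chain intersections of left ideals into
  unions of null sets.\<close>

lemma prob_one_iff_null_complement:
  assumes "closed I"
  shows "conv (point_mass x) (point_mass a) I = 1 \<longleftrightarrow>
    emeasure (to_measure (conv (point_mass x) (point_mass a))) (- I) = 0"
proof -
  let ?\<mu> = "conv (point_mass x) (point_mass a)"
  have nn: "\<And>E. ?\<mu> E \<in> \<real>\<^sub>\<ge>\<^sub>0"
    using conv_point_mass_prob(1)[of x a] by (simp add: nonneg_measures_def)
  have I: "I \<in> sets borel" using assms by simp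
  have total: "emeasure (to_measure ?\<mu>) UNIV = 1"
    by (simp add: emeasure_to_measure conv_point_mass_prob)
  interpret fin: finite_measure "to_measure ?\<mu>"
    by standard (simp add: total)
  have "emeasure (to_measure ?\<mu>) (- I) = 0 \<longleftrightarrow> measure (to_measure ?\<mu>) (- I) = 0"
    by (simp add: fin.emeasure_eq_measure)
  also have "measure (to_measure ?\<mu>) (- I) = 1 - measure (to_measure ?\<mu>) I"
    using fin.finite_measure_compl[of I] I total
    by (simp add: Compl_eq_Diff_UNIV measure_def)
  also have "measure (to_measure ?\<mu>) I = Re (?\<mu> I)"
    using nn[of I] by (simp add: measure_def emeasure_to_measure conv_point_mass_prob I
        complex_nonneg_Reals_iff)
  finally show ?thesis
    using nn[of I] by (auto simp: complex_nonneg_Reals_iff complex_eq_iff)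
qed

lemma left_ideal_iff_null_complement:
  "left_ideal conv I \<longleftrightarrow> closed I \<and> I \<noteq> {} \<and>
    (\<forall>x. \<forall>a\<in>I. emeasure (to_measure (conv (point_mass x) (point_mass a))) (- I) = 0)"
  unfolding left_ideal_def using prob_one_iff_null_complement by blast

lemma left_ideal_Int:
  assumes "left_ideal conv I" "left_ideal conv J" "I \<inter> J \<noteq> {}"
  shows "left_ideal conv (I \<inter> J)"
proof -
  have "emeasure (to_measure (conv (point_mass x) (point_mass a))) (- I \<union> - J) = 0"
    if "a \<in> I \<inter> J" for x a
    using assms that null_sets.Un[of "- I" "to_measure (conv (point_mass x) (point_mass a))" "- J"]
    by (simp add: left_ideal_iff_null_complement null_sets_def borel_open open_Compl)
  then show ?thesis
    using assms by (simp add: left_ideal_iff_null_complement closed_Int)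
qed

text \<open>A non-empty intersection would be a left ideal inside both, hence equal to both.\<close>

lemma minimal_left_ideals_disjoint:
  assumes "minimal_left_ideal conv I" "minimal_left_ideal conv J" "I \<noteq> J"
  shows "I \<inter> J = {}"
  using assms left_ideal_Int[of I J] unfolding minimal_left_ideal_def
  by (metis inf_le1 inf_le2)

text \<open>Zorn's lemma is applied to the open complements of left ideals: an upper bound of a chain is
  its union, which is proper by compactness and null by regularity.\<close>

lemma minimal_left_ideal_exists:
  assumes compact: "compact (UNIV :: 'a set)"
  shows "\<exists>I. minimal_left_ideal conv I"
proof -
  let ?\<A> = "{U. left_ideal conv (- U)}"
  have "left_ideal conv UNIV"
    by (simp add: left_ideal_def conv_point_mass_prob)
  then have "{} \<in> ?\<A>" by simp
  then have "?\<A> \<noteq> {}" by blast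
  moreover have "\<Union>\<C> \<in> ?\<A>" if ne: "\<C> \<noteq> {}" and chain: "subset.chain ?\<A> \<C>" for \<C>
  proof -
    have ideal: "left_ideal conv (- U)" if "U \<in> \<C>" for U
      using chain that by (auto simp: subset_chain_def)
    then have opens: "open U" if "U \<in> \<C>" for U
      using that by (auto simp: left_ideal_def closed_def)
    have "\<Union>\<C> \<noteq> UNIV"
    proof
      assume "\<Union>\<C> = UNIV"
      then obtain U where "U \<in> \<C>" "UNIV \<subseteq> U"
        using compact_subset_Union_chain[OF compact _ chain ne opens] by (metis top_greatest)
      then show False using ideal[of U] by (auto simp: left_ideal_def)
    qed
    moreover have "emeasure (to_measure (conv (point_mass x) (point_mass a))) (\<Union>\<C>) = 0"
      if "a \<notin> \<Union>\<C>" for x a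
    proof (rule emeasure_Union_chain_null[OF conv_point_mass_prob(1) chain ne opens])
      show "emeasure (to_measure (conv (point_mass x) (point_mass a))) U = 0" if "U \<in> \<C>" for U
        using ideal[OF that] \<open>a \<notin> \<Union>\<C>\<close> that by (auto simp: left_ideal_iff_null_complement)
    qed
    ultimately show ?thesis
      using open_Union[of \<C>] opens
      by (auto simp only: left_ideal_iff_null_complement closed_def mem_Collect_eq double_compl)
  qed
  ultimately obtain M where M: "left_ideal conv (- M)"
    and max: "\<And>U. left_ideal conv (- U) \<Longrightarrow> M \<subseteq> U \<Longrightarrow> U = M"
    using subset_Zorn_nonempty[of ?\<A>] by auto
  have "J = - M" if "left_ideal conv J" "J \<subseteq> - M" for J
    using max[of "- J"] that by auto
  then show ?thesis
    using M unfolding minimal_left_ideal_def by blast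
qed

text \<open>For \<open>y \<in> I\<close> the averages \<open>p\<^sub>x * p\<^sub>y\<close> see \<open>f\<close> only on
  \<open>I\<close>, whatever \<open>x\<close> is.\<close>

lemma right_translate_eq_const:
  assumes I: "left_ideal conv I" and y: "y \<in> I"
    and f: "continuous_on UNIV f" "\<And>z. z \<in> I \<Longrightarrow> f z = c"
  shows "right_translate conv y f = (\<lambda>x. c)"
proof
  fix x
  let ?M = "to_measure (conv (point_mass x) (point_mass y))"
  have "- I \<in> null_sets ?M"
    using I y by (auto simp: left_ideal_iff_null_complement null_sets_def)
  then have "AE z in ?M. f z = c"
    by (rule AE_I') (use f(2) in auto)
  moreover have "f \<in> borel_measurable ?M"
    using borel_measurable_continuous_onI[OF f(1)]
    by (simp cong: measurable_cong_sets)
  ultimately have "integral\<^sup>L ?M f = integral\<^sup>L ?M (\<lambda>z. c)"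
    by (intro integral_cong_AE) auto
  also have "\<dots> = c"
    by (simp add: measure_def emeasure_to_measure conv_point_mass_prob)
  finally show "right_translate conv y f x = c"
    by (simp add: right_translate_def)
qed

lemma invariant_mean_eq_const:
  assumes m: "right_invariant_mean conv m" and I: "left_ideal conv I"
    and f: "\<And>z. z \<in> I \<Longrightarrow> apply_bcontfun f z = c"
  shows "m f = c"
proof -
  obtain y where y: "y \<in> I" using I by (auto simp: left_ideal_def)
  have "m f = m (Bcontfun (right_translate conv y (apply_bcontfun f)))"
    using m by (simp add: right_invariant_mean_def)
  also have "right_translate conv y (apply_bcontfun f) = (\<lambda>x. c)"
    by (intro right_translate_eq_const[OF I y _ f]) simp_all
  also have "m (Bcontfun (\<lambda>x. c)) = c * m (const_bcontfun 1)"
    using m unfolding right_invariant_mean_def is_mean_def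
    by (metis (no_types, lifting) const_bcontfun.rep_eq mult.right_neutral ext)
  also have "\<dots> = c"
    using m by (simp add: right_invariant_mean_def is_mean_def)
  finally show ?thesis .
qed

text \<open>Disjoint left ideals could be separated by a continuous function, whose mean would then
  have two different values.\<close>

lemma left_ideals_intersect:
  assumes compact: "compact (UNIV :: 'a set)" and m: "right_invariant_mean conv m"
    and I: "left_ideal conv I" and J: "left_ideal conv J"
  shows "I \<inter> J \<noteq> {}"
proof
  assume disj: "I \<inter> J = {}"
  have "normal_space (euclidean :: 'a topology)"
    using compact by (intro compact_Hausdorff_or_regular_imp_normal_space)
      (auto simp: compact_space_def Hausdorff_space_def disjnt_def separation_t2)
  then obtain h :: "'a \<Rightarrow> real" where h: "continuous_map euclidean (top_of_set {0..1}) h"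
      "h ` J \<subseteq> {0}" "h ` I \<subseteq> {1}"
    using Urysohn_lemma[of euclidean J I 0 1] I J disj
    by (auto simp: left_ideal_def disjnt_def Int_commute)
  define g where "g x = complex_of_real (h x)" for x
  have "continuous_on UNIV g"
    using h(1) unfolding g_def by (auto simp: continuous_map_in_subtopology intro: continuous_intros)
  then have "g \<in> bcontfun"
    using compact_continuous_image[of UNIV g] compact
    by (auto simp: bcontfun_def compact_imp_bounded)
  then have g: "apply_bcontfun (Bcontfun g) = g"
    by (simp add: Bcontfun_inverse)
  have "m (Bcontfun g) = 1"
    using h(3) by (intro invariant_mean_eq_const[OF m I]) (auto simp: g g_def)
  moreover have "m (Bcontfun g) = 0"
    using h(2) by (intro invariant_mean_eq_const[OF m J]) (auto simp: g g_def)
  ultimately show False by simp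
qed

end

theorem theorem5p16:
  fixes conv :: "('a::t2_space set \<Rightarrow> complex) \<Rightarrow> ('a set \<Rightarrow> complex) \<Rightarrow> ('a set \<Rightarrow> complex)"
  assumes "semihypergroup conv"
    and "compact (UNIV :: 'a set)"
    and "right_amenable conv"
  shows "\<exists>!I. minimal_left_ideal conv I"
proof -
  interpret semihypergroup conv by fact
  obtain m where "right_invariant_mean conv m"
    using assms(3) by (auto simp: right_amenable_def)
  then have "I = J" if "minimal_left_ideal conv I" "minimal_left_ideal conv J" for I J
    using left_ideals_intersect[OF assms(2)] minimal_left_ideals_disjoint that
    unfolding minimal_left_ideal_def by blast
  then show ?thesis
    using minimal_left_ideal_exists[OF assms(2)] by blast
qed

end
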